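(* Let $p\in[-1,1]$. The following are 5-periodic orbits (different from the fixed point $P=(\frac15,\frac15,\frac15,\frac15,\frac15)$) of the operator $W$, where $x\to y$ means $W(x)=y$: $$e_1\to e_2\to e_3\to e_4\to e_5\to e_1,$$ $$(\tfrac13,\tfrac13,\tfrac13,0,0)\to(0,\tfrac13,\tfrac13,\tfrac13,0)\to(0,0,\tfrac13,\tfrac13,\tfrac13)\to(\tfrac13,0,0,\tfrac13,\tfrac13)\to(\tfrac13,\tfrac13,0,0,\tfrac13)\to(\tfrac13,\tfrac13,\tfrac13,0,0).$$
   Context: $S^4=\{x=(x_1,\dots,x_5)\in\mathbb{R}^5: x_i\ge 0,\ \sum_{i=1}^5 x_i=1\}$. For $p\in[-1,1]$, the operator $W:S^4\to S^4$, $W(x)=x'$, is defined by $$\begin{aligned} x'_1&=x_5[1+p(x_1-x_2+x_3-x_4)],\\ x'_2&=x_1[1+p(x_2-x_3+x_4-x_5)],\\ x'_3&=x_2[1-p(x_1-x_3+x_4-x_5)],\\ x'_4&=x_3[1+p(x_1-x_2+x_4-x_5)],\\ x'_5&=x_4[1-p(x_1-x_2+x_3-x_5)]. \end{aligned}$$ $e_i$ is the $i$-th standard basis vector of $\mathbb{R}^5$ (a vertex of $S^4$). *)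

theory Defs
  imports "HOL-Analysis.Analysis"
begin

definition S4 :: "(real ^ 5) set" where
  "S4 = {x. (\<forall>i. 0 \<le> x $ i) \<and> (\<Sum>i\<in>UNIV. x $ i) = 1}"

text \<open>
  In the index type \<open>5\<close> the numerals \<open>1, 2, 3, 4, 5\<close> denote the five
  distinct indices (with \<open>5 = 0\<close>); \<open>vector\<close> fills the components in this order.
\<close>

definition W :: "real \<Rightarrow> real ^ 5 \<Rightarrow> real ^ 5" where
  "W p x = vector
     [x $ 5 * (1 + p * (x $ 1 - x $ 2 + x $ 3 - x $ 4)),
      x $ 1 * (1 + p * (x $ 2 - x $ 3 + x $ 4 - x $ 5)),
      x $ 2 * (1 - p * (x $ 1 - x $ 3 + x $ 4 - x $ 5)),
      x $ 3 * (1 + p * (x $ 1 - x $ 2 + x $ 4 - x $ 5)),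
      x $ 4 * (1 - p * (x $ 1 - x $ 2 + x $ 3 - x $ 5))]"

definition e :: "5 \<Rightarrow> real ^ 5" where
  "e i = axis i 1"

definition P :: "real ^ 5" where
  "P = vector [1/5, 1/5, 1/5, 1/5, 1/5]"

text \<open>
  The number \<open>n\<close> is the least period of the points of the orbit, not just some period.
\<close>

definition periodic_orbit :: "'a set \<Rightarrow> ('a \<Rightarrow> 'a) \<Rightarrow> nat \<Rightarrow> 'a set \<Rightarrow> bool" where
  "periodic_orbit S f n A \<longleftrightarrow> 0 < n \<and>
     (\<exists>x\<in>S. (f ^^ n) x = x \<and> (\<forall>k. 0 < k \<and> k < n \<longrightarrow> (f ^^ k) x \<noteq> x) \<and>
       A = {(f ^^ k) x | k. k < n})"

lemma UNIV_5: "(UNIV :: 5 set) = {1, 2, 3, 4, 5}"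
proof -
  have "card {1, 2, 3, 4, 5 :: 5} = CARD(5)" by simp
  then show ?thesis by (intro card_subset_eq[symmetric]) simp_all
qed

lemma vector_5:
  "(vector [a, b, c, d, f] :: real ^ 5) $ 1 = a"
  "(vector [a, b, c, d, f] :: real ^ 5) $ 2 = b"
  "(vector [a, b, c, d, f] :: real ^ 5) $ 3 = c"
  "(vector [a, b, c, d, f] :: real ^ 5) $ 4 = d"
  "(vector [a, b, c, d, f] :: real ^ 5) $ 5 = f"
  by (simp_all add: vector_def)

lemma sum_5: "sum h (UNIV :: 5 set) = h 1 + h 2 + h 3 + h 4 + h 5"
  unfolding UNIV_5 by (simp add: add.assoc)

lemma W_maps_S4:
  assumes "p \<in> {-1..1}"
  shows "W p \<in> S4 \<rightarrow> S4"
proof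
  fix x :: "real ^ 5"
  assume "x \<in> S4"
  then have nn: "0 \<le> x $ i" for i by (simp add: S4_def)
  have s: "x $ 1 + x $ 2 + x $ 3 + x $ 4 + x $ 5 = 1"
    using \<open>x \<in> S4\<close> unfolding S4_def mem_Collect_eq sum_5 by (rule conjunct2)
  have bd: "0 \<le> 1 + p * t \<and> 0 \<le> 1 - p * t" if "\<bar>t\<bar> \<le> 1" for t
  proof -
    have "\<bar>p * t\<bar> \<le> 1 * 1"
      unfolding abs_mult using assms that by (intro mult_mono) auto
    then show ?thesis by linarith
  qed
  note n5 = nn[of 1] nn[of 2] nn[of 3] nn[of 4] nn[of 5]
  have b1: "\<bar>x $ 1 - x $ 2 + x $ 3 - x $ 4\<bar> \<le> 1" using n5 s by linarith
  have b2: "\<bar>x $ 2 - x $ 3 + x $ 4 - x $ 5\<bar> \<le> 1" using n5 s by linarith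
  have b3: "\<bar>x $ 1 - x $ 3 + x $ 4 - x $ 5\<bar> \<le> 1" using n5 s by linarith
  have b4: "\<bar>x $ 1 - x $ 2 + x $ 4 - x $ 5\<bar> \<le> 1" using n5 s by linarith
  have b5: "\<bar>x $ 1 - x $ 2 + x $ 3 - x $ 5\<bar> \<le> 1" using n5 s by linarith
  have "0 \<le> W p x $ i" for i
  proof -
    have "i \<in> {1, 2, 3, 4, 5}" unfolding UNIV_5[symmetric] by (rule UNIV_I)
    then consider "i = 1" | "i = 2" | "i = 3" | "i = 4" | "i = 5" by blast
    then show ?thesis
    proof cases
      case 1 show ?thesis unfolding 1 W_def vector_5
        by (rule mult_nonneg_nonneg[OF nn conjunct1[OF bd[OF b1]]])
    next
      case 2 show ?thesis unfolding 2 W_def vector_5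
        by (rule mult_nonneg_nonneg[OF nn conjunct1[OF bd[OF b2]]])
    next
      case 3 show ?thesis unfolding 3 W_def vector_5
        by (rule mult_nonneg_nonneg[OF nn conjunct2[OF bd[OF b3]]])
    next
      case 4 show ?thesis unfolding 4 W_def vector_5
        by (rule mult_nonneg_nonneg[OF nn conjunct1[OF bd[OF b4]]])
    next
      case 5 show ?thesis unfolding 5 W_def vector_5
        by (rule mult_nonneg_nonneg[OF nn conjunct2[OF bd[OF b5]]])
    qed
  qed
  moreover have "(\<Sum>i\<in>UNIV. W p x $ i) = x $ 1 + x $ 2 + x $ 3 + x $ 4 + x $ 5"
    unfolding sum_5 W_def vector_5 by algebra
  ultimately show "W p x \<in> S4" by (simp add: S4_def s)
qed

end

theory Submission imports Defs begin

text \<open>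
  The five coordinate formulas of \<^const>\<open>W\<close> are one formula: with indices
  modulo 5,
  \<open>W(x)_{i+1} = x_i (1 + p (x_{i+1} - x_{i+2} + x_{i+3} - x_{i+4}))\<close>.
  So \<^const>\<open>W\<close> is the cyclic shift of the coordinates, perturbed in the factor of
  \<open>x_i\<close> by the alternating sum of the other four coordinates. On a point where, for each \<open>i\<close>,
  either \<open>x_i\<close> or this sum vanishes, the perturbation has no effect, and
  \<^const>\<open>W\<close> just rotates the coordinates (\<open>W_rotates\<close>). This condition is itself
  invariant under rotation, so the whole orbit of such a point is its set of rotations. It holds at

  \<^item> a vertex: if \<open>x_i\<close> is the coordinate 1, the other four are all 0;
  \<^item> the centre of a face on three cyclically consecutive vertices: for \<open>x_i\<close> in the
    support, the other two nonzero coordinates are equal and have opposite signs in the sum;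
  \<^item> \<^const>\<open>P\<close>, where all coordinates agree, so that rotation fixes it.

  A vertex and a face centre each have five different rotations, so their orbits have least period
  5 (\<open>periodic_orbit_set\<close>); they have zero coordinates, unlike \<^const>\<open>P\<close>.
\<close>

lemma vector_5_eq_iff:
  "(vector [a, b, c, d, f] :: real ^ 5) = vector [a', b', c', d', f']
     \<longleftrightarrow> a = a' \<and> b = b' \<and> c = c' \<and> d = d' \<and> f = f'"
  (is "?u = ?v \<longleftrightarrow> ?R")
proof
  assume "?u = ?v"
  then have "?u $ i = ?v $ i" for i by simp
  from this[of 1] this[of 2] this[of 3] this[of 4] this[of 5] show ?R
    unfolding vector_5 by blast
qed simp

text \<open>
  The hypotheses are the condition for the perturbation to vanish in each coordinate, so that
  only the cyclic shift remains.
\<close>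

lemma W_rotates:
  assumes "a * (b - c + d - f) = 0" "b * (c - d + f - a) = 0" "c * (d - f + a - b) = 0"
    "d * (f - a + b - c) = 0" "f * (a - b + c - d) = 0"
  shows "W p (vector [a, b, c, d, f]) = vector [f, a, b, c, d]"
  unfolding W_def vector_5 vector_5_eq_iff using assms by auto

lemma vertices_eq_vector:
  "e 1 = vector [1, 0, 0, 0, 0]" "e 2 = vector [0, 1, 0, 0, 0]" "e 3 = vector [0, 0, 1, 0, 0]"
  "e 4 = vector [0, 0, 0, 1, 0]" "e 5 = vector [0, 0, 0, 0, 1]"
proof -
  have all_5: "\<forall>i. Q i" if "Q 1" "Q 2" "Q 3" "Q 4" "Q 5" for Q :: "5 \<Rightarrow> bool"
  proof
    fix i :: 5
    have "i \<in> {1, 2, 3, 4, 5}"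
      unfolding UNIV_5[symmetric] by (rule UNIV_I)
    then show "Q i" using that by blast
  qed
  show
    "e 1 = vector [1, 0, 0, 0, 0]" "e 2 = vector [0, 1, 0, 0, 0]" "e 3 = vector [0, 0, 1, 0, 0]"
    "e 4 = vector [0, 0, 0, 1, 0]" "e 5 = vector [0, 0, 0, 0, 1]"
    unfolding vec_eq_iff by (rule all_5; simp add: e_def axis_def vector_5)+
qed

lemma vector_5_in_S4:
  assumes "0 \<le> a" "0 \<le> b" "0 \<le> c" "0 \<le> d" "0 \<le> f" "a + b + c + d + f = 1"
  shows "vector [a, b, c, d, f] \<in> S4"
proof -
  have "0 \<le> (vector [a, b, c, d, f] :: real ^ 5) $ i" for i
  proof -
    have "i \<in> {1, 2, 3, 4, 5}"
      unfolding UNIV_5[symmetric] by (rule UNIV_I)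
    then show ?thesis
      using assms by (auto simp: vector_5)
  qed
  then show ?thesis
    using assms by (simp add: S4_def sum_5 vector_5)
qed

text \<open>
  Following the list from its head, the \<open>k\<close>-th iterate is the \<open>k\<close>-th entry, with the index
  taken modulo the length; distinctness of the entries makes the length the least period.
\<close>

lemma periodic_orbit_set:
  assumes "xs \<noteq> []" "distinct xs" "hd xs \<in> S"
    and step: "\<And>k. k < length xs \<Longrightarrow> f (xs ! k) = xs ! (Suc k mod length xs)"
  shows "periodic_orbit S f (length xs) (set xs)"
proof -
  have pos: "0 < length xs" using assms(1) by simp
  have iter: "(f ^^ k) (hd xs) = xs ! (k mod length xs)" for k
  proof (induction k)
    case 0
    show ?case using assms(1) by (simp add: hd_conv_nth)
  next
    case (Suc k)
    show ?case using Suc step[of "k mod length xs"] pos by (simp add: mod_Suc_eq)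
  qed
  have "(f ^^ length xs) (hd xs) = hd xs"
    using iter[of "length xs"] iter[of 0] by simp
  moreover have "(f ^^ k) (hd xs) \<noteq> hd xs" if "0 < k" "k < length xs" for k
    using iter[of k] iter[of 0] that \<open>distinct xs\<close> pos by (simp add: nth_eq_iff_index_eq)
  moreover have "set xs = {(f ^^ k) (hd xs) | k. k < length xs}"
    unfolding set_conv_nth by (metis (no_types, lifting) iter mod_less)
  ultimately show ?thesis
    unfolding periodic_orbit_def using pos \<open>hd xs \<in> S\<close> by blast
qed

lemma periodic_orbit_5:
  assumes "f a = b" "f b = c" "f c = d" "f d = g" "f g = a" "a \<in> S" "distinct [a, b, c, d, g]"
  shows "periodic_orbit S f 5 {a, b, c, d, g}"
proof -
  have "periodic_orbit S f (length [a, b, c, d, g]) (set [a, b, c, d, g])"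
  proof (rule periodic_orbit_set)
    fix k assume "k < length [a, b, c, d, g]"
    then consider "k = 0" | "k = 1" | "k = 2" | "k = 3" | "k = 4" by force
    then show "f ([a, b, c, d, g] ! k) = [a, b, c, d, g] ! (Suc k mod length [a, b, c, d, g])"
      by cases (simp_all add: assms(1-5))
  qed (simp_all add: assms(6) assms(7)[simplified])
  then show ?thesis by (simp add: numeral_eq_Suc)
qed

theorem proposition4:
  fixes p :: real
  assumes "p \<in> {-1..1}"
  shows "W p P = P
    \<and> (W p (e 1) = e 2 \<and> W p (e 2) = e 3 \<and> W p (e 3) = e 4 \<and> W p (e 4) = e 5 \<and> W p (e 5) = e 1)
    \<and> periodic_orbit S4 (W p) 5 {e 1, e 2, e 3, e 4, e 5}
    \<and> P \<notin> {e 1, e 2, e 3, e 4, e 5}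
    \<and> (W p (vector [1/3, 1/3, 1/3, 0, 0]) = vector [0, 1/3, 1/3, 1/3, 0]
       \<and> W p (vector [0, 1/3, 1/3, 1/3, 0]) = vector [0, 0, 1/3, 1/3, 1/3]
       \<and> W p (vector [0, 0, 1/3, 1/3, 1/3]) = vector [1/3, 0, 0, 1/3, 1/3]
       \<and> W p (vector [1/3, 0, 0, 1/3, 1/3]) = vector [1/3, 1/3, 0, 0, 1/3]
       \<and> W p (vector [1/3, 1/3, 0, 0, 1/3]) = vector [1/3, 1/3, 1/3, 0, 0])
    \<and> periodic_orbit S4 (W p) 5
        {vector [1/3, 1/3, 1/3, 0, 0], vector [0, 1/3, 1/3, 1/3, 0],
         vector [0, 0, 1/3, 1/3, 1/3], vector [1/3, 0, 0, 1/3, 1/3],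
         vector [1/3, 1/3, 0, 0, 1/3]}
    \<and> P \<notin>
        {vector [1/3, 1/3, 1/3, 0, 0], vector [0, 1/3, 1/3, 1/3, 0],
         vector [0, 0, 1/3, 1/3, 1/3], vector [1/3, 0, 0, 1/3, 1/3],
         vector [1/3, 1/3, 0, 0, 1/3]}"
  (* Written with vector, every transition is a rotation of the argument's entries, including
     the step from P to P, so W_rotates applies to each. *)
  unfolding vertices_eq_vector P_def
  by (intro conjI periodic_orbit_5 W_rotates vector_5_in_S4) (simp_all add: vector_5_eq_iff)

end
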